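(* Let $w=(w(n))_{n\in\mathbb{N}}$ be a nonnegative weight sequence and $0<p<\infty$. The sequence Lorentz space $\gamma_{p,w}$ has the Fatou property.
   Context: $\mathbb{N}$ is the set of positive integers and $\ell^0$ is the set of all real sequences. For $x\in\ell^0$ put $d_x(\lambda)=\operatorname{card}\{k\in\mathbb{N}:|x(k)|>\lambda\}$ for $\lambda\ge 0$, $x^*(n)=\inf\{\lambda\ge 0: d_x(\lambda)\le n-1\}$ (decreasing rearrangement) and $x^{**}(n)=\frac1n\sum_{i=1}^n x^*(i)$ for $n\in\mathbb{N}$. Weight sequences: for the given $0<p<\infty$, a nonnegative weight sequence is a sequence $w=(w(n))_{n\in\mathbb{N}}$ of nonnegative reals, with $w(n)>0$ for at least one $n$, such that $W_p(n)=n^p\sum_{i=n+1}^\infty \frac{w(i)}{i^p}<\infty$ for every $n\in\mathbb{N}$. The sequence Lorentz space $\gamma_{p,w}$ is the space of all $x\in\ell^0$ with $\|x\|_{\gamma_{p,w}}=\left(\sum_{n=1}^\infty (x^{**}(n))^p w(n)\right)^{1/p}<\infty$; it is a quasi-Banach space under this quasi-norm. A quasi-Banach sequence space $E$ has the Fatou property if for every sequence $(x_m)$ of nonnegative elements of $E$ with $\sup_m\|x_m\|_E<\infty$ and $x_m\uparrow x$ pointwise for some $x\in\ell^0$, one has $x\in E$ and $\|x_m\|_E\uparrow\|x\|_E$. *)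

theory Defs
  imports "HOL-Analysis.Analysis"
begin

text \<open>
  A real sequence \<open>(x(k))\<close>, \<open>k = 1, 2, \<dots>\<close>, is represented by a function \<open>x :: nat \<Rightarrow> real\<close>; only its
  values at \<open>k \<ge> 1\<close> matter, and no notion below depends on \<open>x 0\<close>.
  Cardinalities, rearrangements and norms take values in \<open>enat\<close> or \<open>ennreal\<close>, since they may be
  infinite for an arbitrary real sequence (\<open>card\<close> would be \<open>0\<close> on an infinite set).
\<close>

definition distr :: "(nat \<Rightarrow> real) \<Rightarrow> real \<Rightarrow> enat" where
  "distr x t =
     (if finite {k. 1 \<le> k \<and> \<bar>x k\<bar> > t} then enat (card {k. 1 \<le> k \<and> \<bar>x k\<bar> > t}) else \<infinity>)"

text \<open>The infimum of the empty set is \<open>\<infinity>\<close>; this happens exactly when \<open>x\<close> is unbounded.\<close>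

definition rearr :: "(nat \<Rightarrow> real) \<Rightarrow> nat \<Rightarrow> ennreal" where
  "rearr x n = Inf {ennreal t |t. 0 \<le> t \<and> distr x t \<le> enat (n - 1)}"

definition max_rearr :: "(nat \<Rightarrow> real) \<Rightarrow> nat \<Rightarrow> ennreal" where
  "max_rearr x n = (\<Sum>i=1..n. rearr x i) / of_nat n"

text \<open>Real powers on \<open>[0,\<infinity>]\<close>, used for positive exponents only, so that \<open>\<infinity>\<close> is mapped to \<open>\<infinity>\<close>.\<close>

definition ennreal_powr :: "ennreal \<Rightarrow> real \<Rightarrow> ennreal" where
  "ennreal_powr a q = (if a = \<infinity> then \<infinity> else ennreal (enn2real a powr q))"

text \<open>In the series below the summation index is shifted: \<open>n + 1 + j\<close> stands for an index
  \<open>i \<ge> n + 1\<close>, and \<open>Suc j\<close> for an index \<open>n \<ge> 1\<close>.\<close>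

definition weight_tail :: "real \<Rightarrow> (nat \<Rightarrow> real) \<Rightarrow> nat \<Rightarrow> ennreal" where
  "weight_tail p w n =
     ennreal (real n powr p) * (\<Sum>j. ennreal (w (n + 1 + j) / real (n + 1 + j) powr p))"

definition weight_sequence :: "real \<Rightarrow> (nat \<Rightarrow> real) \<Rightarrow> bool" where
  "weight_sequence p w \<longleftrightarrow>
     (\<forall>n\<ge>1. 0 \<le> w n) \<and> (\<exists>n\<ge>1. 0 < w n) \<and> (\<forall>n\<ge>1. weight_tail p w n < \<infinity>)"

definition gamma_enorm :: "real \<Rightarrow> (nat \<Rightarrow> real) \<Rightarrow> (nat \<Rightarrow> real) \<Rightarrow> ennreal" where
  "gamma_enorm p w x =
     ennreal_powr (\<Sum>j. ennreal_powr (max_rearr x (Suc j)) p * ennreal (w (Suc j))) (1 / p)"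

definition gamma_space :: "real \<Rightarrow> (nat \<Rightarrow> real) \<Rightarrow> (nat \<Rightarrow> real) set" where
  "gamma_space p w = {x. gamma_enorm p w x < \<infinity>}"

text \<open>Meaningful on \<open>gamma_space p w\<close> only, as \<open>enn2real \<infinity> = 0\<close>.\<close>

definition gamma_norm :: "real \<Rightarrow> (nat \<Rightarrow> real) \<Rightarrow> (nat \<Rightarrow> real) \<Rightarrow> real" where
  "gamma_norm p w x = enn2real (gamma_enorm p w x)"

text \<open>The space is given by its carrier \<open>E\<close> and its quasi-norm \<open>nrm\<close>; the values of \<open>nrm\<close> outside
  \<open>E\<close> are irrelevant, since \<open>x \<in> E\<close> is part of the conclusion.\<close>

definition fatou_property :: "(nat \<Rightarrow> real) set \<Rightarrow> ((nat \<Rightarrow> real) \<Rightarrow> real) \<Rightarrow> bool" where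
  "fatou_property E nrm \<longleftrightarrow>
     (\<forall>(X :: nat \<Rightarrow> nat \<Rightarrow> real) (x :: nat \<Rightarrow> real).
        (\<forall>m. X m \<in> E \<and> (\<forall>k\<ge>1. 0 \<le> X m k)) \<longrightarrow>
        bdd_above (range (\<lambda>m. nrm (X m))) \<longrightarrow>
        (\<forall>k\<ge>1. incseq (\<lambda>m. X m k) \<and> (\<lambda>m. X m k) \<longlonglongrightarrow> x k) \<longrightarrow>
        x \<in> E \<and> incseq (\<lambda>m. nrm (X m)) \<and> (\<lambda>m. nrm (X m)) \<longlonglongrightarrow> nrm x)"

end

theory Submission
  imports Defs
begin

text \<open>
  The quasi-norm is a composition of maps on \<open>[0,\<infinity>]\<close>-valued data, each of which is monotone and
  commutes with increasing suprema; monotone convergence passes through all of them. The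
  rearrangement is the only non-standard link (\<open>rearr_SUP\<close>). Since the superlevel
  sets of \<open>x\<close> are the increasing unions of those of the \<open>x\<^sub>m\<close>, a bound on all the counts \<open>d(t)\<close> of the
  \<open>x\<^sub>m\<close> is a bound on the count of \<open>x\<close>, and hence the rearrangement of \<open>x\<close> does not exceed
  the supremum of the rearrangements of the \<open>x\<^sub>m\<close>. Averages are finite sums,
  the power maps are order isomorphisms of \<open>[0,\<infinity>]\<close>, and the series over \<open>n\<close> is handled by monotone
  convergence. This gives \<open>\<parallel>x\<parallel> = sup \<parallel>x\<^sub>m\<parallel>\<close> in \<open>[0,\<infinity>]\<close>, and the
  bound on the norms makes this supremum finite, so that \<open>x\<close> lies in the space.
\<close>

text \<open>Stating the bound through finite subsets lets the finite and the infinite case of the count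
  be treated together.\<close>

lemma distr_le_iff:
  "distr x t \<le> enat N \<longleftrightarrow>
     (\<forall>F. finite F \<longrightarrow> F \<subseteq> {k. 1 \<le> k \<and> \<bar>x k\<bar> > t} \<longrightarrow> card F \<le> N)"
proof (cases "finite {k. 1 \<le> k \<and> \<bar>x k\<bar> > t}")
  case True
  then show ?thesis
    unfolding distr_def by (auto intro: card_mono order_trans)
next
  case False
  then obtain F where "finite F" "card F = Suc N" "F \<subseteq> {k. 1 \<le> k \<and> \<bar>x k\<bar> > t}"
    by (meson infinite_arbitrarily_large)
  with False show ?thesis
    unfolding distr_def by (auto simp: not_le intro!: exI[of _ F])
qed

lemma distr_le_mono:
  assumes "distr y s \<le> enat N" "s \<le> t" "\<And>k. 1 \<le> k \<Longrightarrow> \<bar>x k\<bar> \<le> \<bar>y k\<bar>"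
  shows "distr x t \<le> enat N"
proof -
  have "{k. 1 \<le> k \<and> \<bar>x k\<bar> > t} \<subseteq> {k. 1 \<le> k \<and> \<bar>y k\<bar> > s}"
    using assms(2,3) by (auto intro: le_less_trans less_le_trans)
  with assms(1) show ?thesis
    unfolding distr_le_iff by blast
qed

lemma rearr_mono:
  assumes "\<And>k. 1 \<le> k \<Longrightarrow> \<bar>x k\<bar> \<le> \<bar>y k\<bar>"
  shows "rearr x n \<le> rearr y n"
  unfolding rearr_def
  using distr_le_mono[where x = x and y = y, OF _ order_refl assms]
  by (intro Inf_superset_mono Collect_mono) blast

lemma distr_le_of_rearr_less:
  assumes "rearr x n < ennreal r"
  shows "distr x r \<le> enat (n - 1)"
proof -
  obtain t where t: "0 \<le> t" "distr x t \<le> enat (n - 1)" "ennreal t < ennreal r"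
    using assms unfolding rearr_def Inf_less_iff by blast
  then have "t \<le> r"
    by (simp add: ennreal_less_iff)
  with t(2) show ?thesis
    using distr_le_mono by blast
qed

text \<open>A finite set inside the superlevel set of the limit lies in that of \<open>X m\<close> for all large \<open>m\<close>,
  since each of its finitely many points satisfies the strict inequality eventually.\<close>

lemma distr_le_of_limit:
  assumes lim: "\<And>k. 1 \<le> k \<Longrightarrow> (\<lambda>m. X m k) \<longlonglongrightarrow> x k"
    and le: "\<And>m. distr (X m) t \<le> enat N"
  shows "distr x t \<le> enat N"
  unfolding distr_le_iff
proof (intro allI impI)
  fix F assume F: "finite F" "F \<subseteq> {k. 1 \<le> k \<and> \<bar>x k\<bar> > t}"
  have "\<forall>\<^sub>F m in sequentially. t < \<bar>X m k\<bar>" if "k \<in> F" for k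
    using that F lim[of k] by (intro order_tendstoD(1)[OF tendsto_rabs]) auto
  with \<open>finite F\<close> have "\<forall>\<^sub>F m in sequentially. \<forall>k\<in>F. t < \<bar>X m k\<bar>"
    by (simp add: eventually_ball_finite_distrib)
  then obtain m where "\<forall>k\<in>F. t < \<bar>X m k\<bar>"
    by (auto simp: eventually_sequentially)
  with F have "F \<subseteq> {k. 1 \<le> k \<and> \<bar>X m k\<bar> > t}"
    by auto
  with le[of m] \<open>finite F\<close> show "card F \<le> N"
    unfolding distr_le_iff by blast
qed

text \<open>Working with levels strictly above the supremum avoids the question whether the infimum that
  defines the rearrangement is attained.\<close>

lemma rearr_SUP:
  assumes dom: "\<And>m k. 1 \<le> k \<Longrightarrow> \<bar>X m k\<bar> \<le> \<bar>x k\<bar>"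
    and lim: "\<And>k. 1 \<le> k \<Longrightarrow> (\<lambda>m. X m k) \<longlonglongrightarrow> x k"
  shows "rearr x n = (SUP m. rearr (X m) n)"
proof (rule antisym)
  show "rearr x n \<le> (SUP m. rearr (X m) n)"
  proof (rule dense_ge)
    fix z assume z: "(SUP m. rearr (X m) n) < z"
    show "rearr x n \<le> z"
    proof (cases z)
      case (real r)
      have "rearr (X m) n < ennreal r" for m
        using z real by (metis SUP_lessD UNIV_I)
      then have "distr x r \<le> enat (n - 1)"
        by (intro distr_le_of_limit[OF lim] distr_le_of_rearr_less)
      with real show ?thesis
        unfolding rearr_def by (auto intro!: Inf_lower)
    qed simp
  qed
  show "(SUP m. rearr (X m) n) \<le> rearr x n"
    by (intro SUP_least rearr_mono dom)
qed

lemma max_rearr_mono: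
  assumes "\<And>k. 1 \<le> k \<Longrightarrow> \<bar>x k\<bar> \<le> \<bar>y k\<bar>"
  shows "max_rearr x n \<le> max_rearr y n"
  unfolding max_rearr_def by (intro divide_right_mono_ennreal sum_mono rearr_mono assms)

lemma max_rearr_SUP:
  assumes "\<And>m k. 1 \<le> k \<Longrightarrow> \<bar>X m k\<bar> \<le> \<bar>x k\<bar>"
    and "\<And>k. 1 \<le> k \<Longrightarrow> (\<lambda>m. X m k) \<longlonglongrightarrow> x k"
    and inc: "\<And>k l m. 1 \<le> k \<Longrightarrow> l \<le> m \<Longrightarrow> \<bar>X l k\<bar> \<le> \<bar>X m k\<bar>"
  shows "max_rearr x n = (SUP m. max_rearr (X m) n)"
proof -
  have "(\<Sum>i=1..n. rearr x i) = (SUP m. \<Sum>i=1..n. rearr (X m) i)"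
    using rearr_SUP[of X x, OF assms(1,2)]
    by (subst ennreal_SUP_sum) (auto intro!: incseq_SucI rearr_mono inc)
  then show ?thesis
    unfolding max_rearr_def by (simp add: SUP_divide_ennreal)
qed

lemma ennreal_powr_mono:
  assumes "0 \<le> q" "a \<le> b"
  shows "ennreal_powr a q \<le> ennreal_powr b q"
proof (cases "b = \<infinity>")
  case False
  with assms have "a \<noteq> \<infinity>" "enn2real a \<le> enn2real b"
    by (auto simp: top_unique enn2real_mono less_top)
  with False assms show ?thesis
    unfolding ennreal_powr_def by (auto intro!: ennreal_leI powr_mono2)
qed (simp add: ennreal_powr_def)

lemma ennreal_powr_inverse:
  assumes "q * r = 1"
  shows "ennreal_powr (ennreal_powr a q) r = a"
  using assms by (cases a) (auto simp: ennreal_powr_def powr_powr)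

text \<open>A monotone map with a monotone inverse preserves arbitrary suprema, so no continuity argument
  is needed.\<close>

lemma ennreal_powr_SUP:
  assumes "0 < q"
  shows "ennreal_powr (SUP i\<in>I. f i) q = (SUP i\<in>I. ennreal_powr (f i) q)" (is "_ = ?S")
proof (rule antisym)
  have "f i \<le> ennreal_powr ?S (1 / q)" if "i \<in> I" for i
  proof -
    have "ennreal_powr (ennreal_powr (f i) q) (1 / q) \<le> ennreal_powr ?S (1 / q)"
      using assms that by (intro ennreal_powr_mono SUP_upper) auto
    with assms show ?thesis
      by (simp add: ennreal_powr_inverse)
  qed
  then have "ennreal_powr (SUP i\<in>I. f i) q \<le> ennreal_powr (ennreal_powr ?S (1 / q)) q"
    using assms by (intro ennreal_powr_mono SUP_least) auto
  with assms show "ennreal_powr (SUP i\<in>I. f i) q \<le> ?S"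
    by (simp add: ennreal_powr_inverse)
  show "?S \<le> ennreal_powr (SUP i\<in>I. f i) q"
    using assms by (intro SUP_least ennreal_powr_mono SUP_upper) auto
qed

lemma gamma_enorm_mono:
  assumes "0 < p" "\<And>k. 1 \<le> k \<Longrightarrow> \<bar>x k\<bar> \<le> \<bar>y k\<bar>"
  shows "gamma_enorm p w x \<le> gamma_enorm p w y"
  unfolding gamma_enorm_def using assms
  by (intro ennreal_powr_mono suminf_le mult_right_mono max_rearr_mono) auto

lemma gamma_enorm_SUP:
  assumes "0 < p"
    and "\<And>m k. 1 \<le> k \<Longrightarrow> \<bar>X m k\<bar> \<le> \<bar>x k\<bar>"
    and "\<And>k. 1 \<le> k \<Longrightarrow> (\<lambda>m. X m k) \<longlonglongrightarrow> x k"
    and inc: "\<And>k l m. 1 \<le> k \<Longrightarrow> l \<le> m \<Longrightarrow> \<bar>X l k\<bar> \<le> \<bar>X m k\<bar>"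
  shows "gamma_enorm p w x = (SUP m. gamma_enorm p w (X m))"
proof -
  let ?f = "\<lambda>y j. ennreal_powr (max_rearr y (Suc j)) p * ennreal (w (Suc j))"
  have "?f x j = (SUP m. ?f (X m) j)" for j
    using \<open>0 < p\<close> by (simp add: max_rearr_SUP[of X x, OF assms(2-4)] ennreal_powr_SUP
        SUP_mult_right_ennreal)
  moreover have "incseq (\<lambda>m. ?f (X m) j)" for j
    using \<open>0 < p\<close> by (intro incseq_SucI mult_right_mono ennreal_powr_mono max_rearr_mono inc) auto
  ultimately have "(\<Sum>j. ?f x j) = (SUP m. \<Sum>j. ?f (X m) j)"
    using ennreal_suminf_SUP_eq[of "\<lambda>m. ?f (X m)"] by simp
  then show ?thesis
    unfolding gamma_enorm_def using \<open>0 < p\<close> by (simp add: ennreal_powr_SUP)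
qed

theorem lemma4p3:
  fixes p :: real and w :: "nat \<Rightarrow> real"
  assumes "0 < p"
    and "weight_sequence p w"
  shows "fatou_property (gamma_space p w) (gamma_norm p w)"
  unfolding fatou_property_def
proof (intro allI impI)
  fix X :: "nat \<Rightarrow> nat \<Rightarrow> real" and x :: "nat \<Rightarrow> real"
  let ?N = "gamma_enorm p w"
  assume X: "\<forall>m. X m \<in> gamma_space p w \<and> (\<forall>k\<ge>1. 0 \<le> X m k)"
    and bdd: "bdd_above (range (\<lambda>m. gamma_norm p w (X m)))"
    and conv: "\<forall>k\<ge>1. incseq (\<lambda>m. X m k) \<and> (\<lambda>m. X m k) \<longlonglongrightarrow> x k"
  have inc: "\<bar>X l k\<bar> \<le> \<bar>X m k\<bar>" if "1 \<le> k" "l \<le> m" for k l m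
    using X conv that by (simp add: incseq_def)
  have dom: "\<bar>X m k\<bar> \<le> \<bar>x k\<bar>" if "1 \<le> k" for m k
    using X conv that by (metis abs_of_nonneg incseq_le order_trans)
  have SUP: "?N x = (SUP m. ?N (X m))"
    using assms(1) dom inc conv by (intro gamma_enorm_SUP) auto
  have mono: "incseq (\<lambda>m. ?N (X m))"
    using assms(1) inc by (intro incseq_SucI gamma_enorm_mono) auto
  have fin: "?N (X m) < \<infinity>" for m
    using X by (simp add: gamma_space_def)
  obtain B where B: "\<And>m. gamma_norm p w (X m) \<le> B"
    using bdd by (auto simp: bdd_above_def)
  have "?N (X m) \<le> ennreal B" for m
    using fin[of m] ennreal_leI[OF B[of m]] by (simp add: gamma_norm_def)
  then have "?N x \<le> ennreal B"
    unfolding SUP by (rule SUP_least)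
  then have finx: "?N x < \<infinity>"
    using ennreal_less_top le_less_trans by fastforce
  have "(\<lambda>m. ?N (X m)) \<longlonglongrightarrow> ?N x"
    unfolding SUP by (rule LIMSEQ_SUP[OF mono])
  then have "(\<lambda>m. gamma_norm p w (X m)) \<longlonglongrightarrow> gamma_norm p w x"
    unfolding gamma_norm_def using finx by (intro tendsto_enn2real) auto
  moreover have "incseq (\<lambda>m. gamma_norm p w (X m))"
    unfolding gamma_norm_def using mono fin
    by (intro incseq_SucI enn2real_mono) (auto simp: incseq_Suc_iff)
  ultimately show "x \<in> gamma_space p w \<and> incseq (\<lambda>m. gamma_norm p w (X m)) \<and>
      (\<lambda>m. gamma_norm p w (X m)) \<longlonglongrightarrow> gamma_norm p w x"
    using finx by (simp add: gamma_space_def)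
qed

end
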